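(* For the single-machine makespan problem with uniform linear deterioration and release times, the Non-Idling algorithm is $(1+e)$-approximate on instances with $\beta\le 1/n$, where $n$ is the number of jobs, and there are instances on which the ratio of its makespan to the optimal makespan is $\Omega((1+\beta)^n)$, i.e.\ it is $\Omega((1+\beta)^n)$-approximate for general instances.
   Context: Problem: a single machine must process a set $\mathcal{J}=\{1,\ldots,n\}$ of jobs non-preemptively, at most one job at a time. Job $i$ has a release time $r_i\ge 0$ and a fixed processing time $\alpha_i\ge 0$, and there is a common deterioration rate $\beta>0$. If job $i$ starts at time $s_i\ge r_i$, its processing time is $p_i(s_i)=\alpha_i+\beta s_i$, so it completes at $C_i=(1+\beta)s_i+\alpha_i$. A schedule is feasible if jobs do not overlap and $s_i\ge r_i$. The makespan is $\max_i C_i$; $T^*$ is the optimal makespan. An algorithm is $\rho$-approximate if its makespan is always at most $\rho T^*$. A job is pending at time $t$ if it is released by $t$ and has not started before $t$. Non-Idling algorithm: jobs are scheduled greedily over time; at each time $t$ that the machine becomes available and some job is pending, a pending job with minimum fixed processing time $\alpha_i$ is started at time $t$ (if no job is pending the machine waits for the next release). *)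

theory Defs
  imports Complex_Main
begin

record problem =
  num_jobs :: nat
  release :: "nat \<Rightarrow> real"
  fixed_time :: "nat \<Rightarrow> real"
  rate :: real

definition jobs :: "problem \<Rightarrow> nat set" where
  "jobs I = {1..num_jobs I}"

definition valid_problem :: "problem \<Rightarrow> bool" where
  "valid_problem I \<longleftrightarrow>
     1 \<le> num_jobs I \<and> 0 < rate I \<and>
     (\<forall>i\<in>jobs I. 0 \<le> release I i \<and> 0 \<le> fixed_time I i)"

definition proc_time :: "problem \<Rightarrow> nat \<Rightarrow> real \<Rightarrow> real" where
  "proc_time I i t = fixed_time I i + rate I * t"

definition completion :: "problem \<Rightarrow> nat \<Rightarrow> real \<Rightarrow> real" where
  "completion I i t = t + proc_time I i t"

text \<open>A schedule is the function of start times; only its values on the jobs matter.\<close>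

type_synonym schedule = "nat \<Rightarrow> real"

text \<open>Processing times may be zero (fixed time 0, start time 0). The condition below then
  lets several such jobs share a start time, but never lets one lie strictly inside the
  processing interval of another job.\<close>

definition feasible :: "problem \<Rightarrow> schedule \<Rightarrow> bool" where
  "feasible I s \<longleftrightarrow>
     (\<forall>i\<in>jobs I. release I i \<le> s i) \<and>
     (\<forall>i\<in>jobs I. \<forall>j\<in>jobs I. i \<noteq> j \<longrightarrow>
        completion I i (s i) \<le> s j \<or> completion I j (s j) \<le> s i)"

definition makespan :: "problem \<Rightarrow> schedule \<Rightarrow> real" where
  "makespan I s = Max ((\<lambda>i. completion I i (s i)) ` jobs I)"

definition opt_makespan :: "problem \<Rightarrow> real" where
  "opt_makespan I = Inf (makespan I ` {s. feasible I s})"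

text \<open>An algorithm is the relation between a problem and its possible outputs, so that
  choices it leaves open (such as tie-breaking) are covered by all outputs.\<close>

definition is_approximate ::
  "(problem \<Rightarrow> schedule \<Rightarrow> bool) \<Rightarrow> problem set \<Rightarrow> real \<Rightarrow> bool" where
  "is_approximate alg X \<rho> \<longleftrightarrow>
     (\<forall>I\<in>X. (\<exists>s. alg I s) \<and>
        (\<forall>s. alg I s \<longrightarrow> feasible I s \<and> makespan I s \<le> \<rho> * opt_makespan I))"

definition pending :: "problem \<Rightarrow> nat set \<Rightarrow> real \<Rightarrow> nat set" where
  "pending I S t = {i \<in> jobs I - S. release I i \<le> t}"

text \<open>\<open>non_idling_run I t S s\<close>: the algorithm can reach a state in which the machine is
  available at time \<open>t\<close> and exactly the jobs in \<open>S\<close> have been started, at the times \<open>s\<close>.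
  The set \<open>S\<close> is kept explicitly because start times alone do not determine the order of
  jobs with zero processing time.\<close>

inductive non_idling_run :: "problem \<Rightarrow> real \<Rightarrow> nat set \<Rightarrow> schedule \<Rightarrow> bool" for I where
  init: "non_idling_run I 0 {} (\<lambda>_. 0)"
| start: "\<lbrakk>non_idling_run I t S s; i \<in> pending I S t;
     \<forall>j\<in>pending I S t. fixed_time I i \<le> fixed_time I j\<rbrakk>
   \<Longrightarrow> non_idling_run I (completion I i t) (insert i S) (s(i := t))"
| wait: "\<lbrakk>non_idling_run I t S s; pending I S t = {}; jobs I - S \<noteq> {}\<rbrakk>
   \<Longrightarrow> non_idling_run I (Min (release I ` (jobs I - S))) S s"

definition non_idling :: "problem \<Rightarrow> schedule \<Rightarrow> bool" where
  "non_idling I s \<longleftrightarrow> (\<exists>t. non_idling_run I t (jobs I) s)"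

end

theory Submission
  imports Defs
begin

text \<open>Upper bound: let \<open>r\<close> be the end of the last idle period of the algorithm and \<open>B\<close> the set of
  jobs it runs after \<open>r\<close>. They run back to back, so the makespan is at most
  \<open>(1 + \<beta>) ^ card B * (r + (\<Sum>i\<in>B. \<alpha> i))\<close>, where the first factor is at most \<open>exp 1\<close>. Since all jobs in
  \<open>B\<close> are released at \<open>r\<close> or later, every schedule needs at least \<open>r + (\<Sum>i\<in>B. \<alpha> i)\<close>.

  Lower bound: a job with fixed time 1 is released at 0, and \<open>n - 1\<close> jobs with fixed time 0 at
  \<open>(1 + \<beta>) ^ (-n)\<close>. The algorithm runs the long job first and the others grow to
  \<open>(1 + \<beta>) ^ (n - 1)\<close>; running the long job last gives makespan 2.\<close>

section \<open>Completion times, makespans and feasible schedules\<close>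

lemma finite_jobs [simp]: "finite (jobs I)"
  by (simp add: jobs_def)

lemma completion_eq: "completion I i t = (1 + rate I) * t + fixed_time I i"
  by (simp add: completion_def proc_time_def algebra_simps)

lemma completion_ge:
  assumes "valid_problem I" "i \<in> jobs I" "0 \<le> t"
  shows "t + fixed_time I i \<le> completion I i t"
  using assms by (simp add: completion_def proc_time_def valid_problem_def)

lemma completion_le_makespan: "i \<in> jobs I \<Longrightarrow> completion I i (s i) \<le> makespan I s"
  unfolding makespan_def by (rule Max_ge) auto

lemma jobs_nonempty: "valid_problem I \<Longrightarrow> jobs I \<noteq> {}"
  by (simp add: valid_problem_def jobs_def)

lemma makespan_leI:
  assumes "valid_problem I" "\<And>i. i \<in> jobs I \<Longrightarrow> completion I i (s i) \<le> T"
  shows "makespan I s \<le> T"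
  unfolding makespan_def using assms jobs_nonempty[OF assms(1)] by (subst Max_le_iff) auto

lemma feasible_release: "feasible I s \<Longrightarrow> i \<in> jobs I \<Longrightarrow> release I i \<le> s i"
  by (simp add: feasible_def)

lemma feasible_disjoint:
  "feasible I s \<Longrightarrow> i \<in> jobs I \<Longrightarrow> j \<in> jobs I \<Longrightarrow> i \<noteq> j \<Longrightarrow>
    completion I i (s i) \<le> s j \<or> completion I j (s j) \<le> s i"
  by (simp add: feasible_def)

lemma feasible_nonneg:
  assumes "valid_problem I" "feasible I s" "i \<in> jobs I"
  shows "0 \<le> s i"
  using assms feasible_release[OF assms(2,3)] by (force simp: valid_problem_def)

section \<open>Lower bounds on feasible and optimal makespans\<close>

text \<open>Induction adding the jobs in order of start time: the job completing late among the
  earlier ones ends before the new one starts, so the new one adds its fixed time on top. Naming a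
  concrete job, not just bounding a maximum, lets disjointness be applied to it.\<close>

lemma exists_late_completion:
  assumes val: "valid_problem I" and feas: "feasible I s"
    and "finite B" "B \<subseteq> jobs I" "\<forall>i\<in>B. r \<le> release I i" "B \<noteq> {}"
  shows "\<exists>i\<in>B. r + (\<Sum>j\<in>B. fixed_time I j) \<le> completion I i (s i)"
  using assms(3-)
proof (induction B rule: finite_ranking_induct[where f = s])
  case empty
  then show ?case by simp
next
  case (insert x B)
  have xj: "x \<in> jobs I" and Bj: "B \<subseteq> jobs I" using insert.prems by auto
  have cx: "s x + fixed_time I x \<le> completion I x (s x)"
    using completion_ge[OF val xj feasible_nonneg[OF val feas xj]] .
  have rx: "r \<le> s x" using insert.prems feasible_release[OF feas xj] by force
  show ?case
  \<comment> \<open>The ranking induction does not guarantee \<open>x \<notin> B\<close>, and its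
    hypothesis says nothing for \<open>B = {}\<close>; both cases are split off here.\<close>
  proof (cases "x \<in> B \<or> B = {}")
    case True
    then show ?thesis
    proof
      assume "x \<in> B"
      then show ?thesis using insert.IH insert.prems by (auto simp: insert_absorb)
    next
      assume "B = {}"
      then show ?thesis using cx rx by simp
    qed
  next
    case False
    then obtain j where j: "j \<in> B" "r + (\<Sum>j\<in>B. fixed_time I j) \<le> completion I j (s j)"
      using insert.IH insert.prems by auto
    have sum: "(\<Sum>j\<in>insert x B. fixed_time I j) = fixed_time I x + (\<Sum>j\<in>B. fixed_time I j)"
      using False insert.hyps by simp
    have "completion I j (s j) \<le> s x \<or> completion I x (s x) \<le> s j"
      using feasible_disjoint[OF feas, of j x] j(1) Bj xj False by auto
    then show ?thesis
    proof
      assume "completion I j (s j) \<le> s x"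
      then show ?thesis using j cx sum by (intro bexI[of _ x]) auto
    next
      assume "completion I x (s x) \<le> s j"
      \<comment> \<open>As \<open>x\<close> starts last, this forces \<open>x\<close> to have length 0.\<close>
      moreover have "s j \<le> s x" using insert.hyps j(1) by blast
      ultimately have "fixed_time I x \<le> 0" using cx by linarith
      then show ?thesis using j sum by (intro bexI[of _ j]) auto
    qed
  qed
qed

lemma makespan_ge_release_plus_work:
  assumes "valid_problem I" "feasible I s"
    and B: "B \<subseteq> jobs I" "\<forall>i\<in>B. r \<le> release I i" "B \<noteq> {}"
  shows "r + (\<Sum>j\<in>B. fixed_time I j) \<le> makespan I s"
proof -
  have "finite B" using B(1) finite_jobs by (rule finite_subset)
  then obtain i where "i \<in> B" "r + (\<Sum>j\<in>B. fixed_time I j) \<le> completion I i (s i)"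
    using exists_late_completion[OF assms(1,2) _ B] by blast
  then show ?thesis using B(1) completion_le_makespan[of i I s] by force
qed

lemma opt_makespan_greatest:
  assumes "feasible I s" "\<And>s'. feasible I s' \<Longrightarrow> T \<le> makespan I s'"
  shows "T \<le> opt_makespan I"
  unfolding opt_makespan_def by (rule cInf_greatest) (use assms in auto)

text \<open>The bound \<open>T\<close> makes the set of makespans bounded below, so that the real
  \<open>Inf\<close> is a lower bound of it.\<close>

lemma opt_makespan_lower:
  assumes "feasible I s" "\<And>s'. feasible I s' \<Longrightarrow> T \<le> makespan I s'"
  shows "opt_makespan I \<le> makespan I s"
  unfolding opt_makespan_def by (rule cInf_lower) (use assms in \<open>auto intro!: bdd_belowI[of _ T]\<close>)

section \<open>Runs of the algorithm: feasibility, final time and existence\<close>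

lemma Min_release_in:
  assumes "jobs I - S \<noteq> {}"
  shows "Min (release I ` (jobs I - S)) \<in> release I ` (jobs I - S)"
  using assms by (intro Min_in) auto

lemma wait_forward:
  assumes "pending I S t = {}" "jobs I - S \<noteq> {}"
  shows "t < Min (release I ` (jobs I - S))"
  using Min_release_in[OF assms(2)] assms(1) by (force simp: pending_def)

text \<open>Invariant of a run: all started jobs are completed by the clock time \<open>t\<close>,
  so a job started at \<open>t\<close> overlaps none of them.\<close>

lemma run_feasible:
  assumes val: "valid_problem I" and "non_idling_run I t S s"
  shows "0 \<le> t \<and> S \<subseteq> jobs I \<and>
    (\<forall>i\<in>S. release I i \<le> s i \<and> completion I i (s i) \<le> t) \<and>
    (\<forall>i\<in>S. \<forall>j\<in>S. i \<noteq> j \<longrightarrow> completion I i (s i) \<le> s j \<or> completion I j (s j) \<le> s i)"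
  using assms(2)
proof induction
  case init
  then show ?case by simp
next
  case (start t S s i)
  have i: "i \<in> jobs I" "i \<notin> S" "release I i \<le> t" using start.hyps by (auto simp: pending_def)
  have "t + fixed_time I i \<le> completion I i t" using completion_ge[OF val i(1)] start.IH by blast
  moreover have "0 \<le> fixed_time I i" using val i(1) by (simp add: valid_problem_def)
  ultimately have "t \<le> completion I i t" by linarith
  then show ?case using start.IH i by (force simp: fun_upd_def)
next
  case (wait t S s)
  have "t \<le> Min (release I ` (jobs I - S))" using wait_forward[OF wait.hyps(2,3)] by simp
  then show ?case using wait.IH by (meson order_trans)
qed

lemma non_idling_feasible: "valid_problem I \<Longrightarrow> non_idling I s \<Longrightarrow> feasible I s"
  unfolding non_idling_def feasible_def using run_feasible by blast

text \<open>A run that has started every job cannot end with a wait, which needs an unstarted job;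
  its last step is the start of a job that completes at \<open>t\<close>.\<close>

lemma run_end_completion:
  assumes "valid_problem I" "non_idling_run I t S s" "S = jobs I"
  shows "\<exists>i\<in>S. completion I i (s i) = t"
  using assms(2,3)
proof cases
  case init
  then show ?thesis using assms(3) jobs_nonempty[OF assms(1)] by auto
next
  case (start t' S' s' i)
  then show ?thesis by (intro bexI[of _ i]) simp_all
next
  case wait
  then show ?thesis using assms(3) by simp
qed

lemma makespan_run:
  assumes "valid_problem I" "non_idling_run I t (jobs I) s"
  shows "makespan I s = t"
proof (rule antisym)
  show "makespan I s \<le> t"
    using run_feasible[OF assms] by (intro makespan_leI[OF assms(1)]) auto
  show "t \<le> makespan I s"
    using run_end_completion[OF assms refl] completion_le_makespan by fastforce
qed

text \<open>At most one wait precedes the next start, since a job is pending at the earliest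
  remaining release time.\<close>

lemma run_extend:
  assumes run: "non_idling_run I t S s" and S: "S \<subseteq> jobs I" "S \<noteq> jobs I"
  shows "\<exists>t' i s'. i \<in> jobs I - S \<and> non_idling_run I t' (insert i S) s'"
proof -
  \<comment> \<open>The time is generalised because the step is taken either at the current time or
    after a wait.\<close>
  have step: ?thesis if run: "non_idling_run I t S s" and ne: "pending I S t \<noteq> {}" for t
  proof -
    have "finite (pending I S t)" by (simp add: pending_def)
    from ex_min_if_finite[OF finite_imageI[OF this, of "fixed_time I"]]
    obtain i where i: "i \<in> pending I S t"
      "\<forall>j\<in>pending I S t. fixed_time I i \<le> fixed_time I j"
      using ne by (auto simp: not_less)
    then show ?thesis
      using non_idling_run.start[OF run i] by (auto simp: pending_def)
  qed
  show ?thesis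
  proof (cases "pending I S t = {}")
    case True
    have ne: "jobs I - S \<noteq> {}" using S by blast
    have "pending I S (Min (release I ` (jobs I - S))) \<noteq> {}"
      using Min_release_in[OF ne] by (force simp: pending_def)
    then show ?thesis using step[OF non_idling_run.wait[OF run True ne]] by blast
  qed (use step[OF run] in blast)
qed

text \<open>Induction on the number \<open>k\<close> of started jobs; this keeps statements about
  all outputs from being vacuous.\<close>

lemma non_idling_total: "\<exists>s. non_idling I s"
proof -
  have "\<exists>t s S. non_idling_run I t S s \<and> S \<subseteq> jobs I \<and> card S = k" if "k \<le> num_jobs I" for k
    using that
  proof (induction k)
    case 0
    then show ?case using non_idling_run.init[of I] by force
  next
    case (Suc k)
    then obtain t s S where S: "non_idling_run I t S s" "S \<subseteq> jobs I" "card S = k" by auto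
    have "S \<noteq> jobs I" using S(3) Suc.prems by (auto simp: jobs_def)
    from run_extend[OF S(1,2) this] obtain t' i s' where
      "i \<in> jobs I - S" "non_idling_run I t' (insert i S) s'" by blast
    moreover have "finite S" using S(2) finite_jobs by (rule finite_subset)
    ultimately show ?case using S by (intro exI[of _ t'] exI[of _ s'] exI[of _ "insert i S"]) auto
  qed
  then obtain t s S where S: "non_idling_run I t S s" "S \<subseteq> jobs I" "card S = num_jobs I" by blast
  then have "S = jobs I" by (intro card_subset_eq) (auto simp: jobs_def)
  then show ?thesis using S(1) by (auto simp: non_idling_def)
qed

section \<open>Upper bound for small deterioration rates\<close>

text \<open>Here \<open>r\<close> is the end of the last wait (0 if there was none) and
  \<open>B\<close> the set of jobs started since. The release bound also covers unstarted jobs, so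
  that it survives when one of them joins \<open>B\<close>. Right after a wait \<open>B\<close> is
  empty, but then some job is still unstarted.\<close>

lemma run_busy_block:
  assumes val: "valid_problem I" and "non_idling_run I t S s"
  shows "\<exists>r B. 0 \<le> r \<and> B \<subseteq> S \<and> (S = jobs I \<longrightarrow> B \<noteq> {}) \<and>
    (\<forall>i\<in>B \<union> (jobs I - S). r \<le> release I i) \<and>
    t \<le> (1 + rate I) ^ card B * (r + (\<Sum>i\<in>B. fixed_time I i))"
  using assms(2)
proof induction
  case init
  then show ?case using val jobs_nonempty[OF val]
    by (intro exI[of _ 0] exI[of _ "{}"]) (auto simp: valid_problem_def)
next
  case (start t S s i)
  then obtain r B where B: "0 \<le> r" "B \<subseteq> S" "\<forall>i\<in>B \<union> (jobs I - S). r \<le> release I i"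
    "t \<le> (1 + rate I) ^ card B * (r + (\<Sum>i\<in>B. fixed_time I i))"
    by blast
  have i: "i \<in> jobs I" "i \<notin> S" using start.hyps by (auto simp: pending_def)
  have "S \<subseteq> jobs I" using run_feasible[OF val start.hyps(1)] by blast
  then have fin: "finite B" using B(2) finite_jobs by (meson finite_subset subset_trans)
  have iB: "i \<notin> B" using B(2) i(2) by blast
  have rate: "0 \<le> rate I" and fi: "0 \<le> fixed_time I i"
    using val i(1) by (auto simp: valid_problem_def)
  have "completion I i t \<le> (1 + rate I) *
      ((1 + rate I) ^ card B * (r + (\<Sum>i\<in>B. fixed_time I i))) + fixed_time I i"
    unfolding completion_eq using B(4) rate by (intro add_mono mult_left_mono) auto
  \<comment> \<open>The new fixed time is inflated by the full growth factor, so that it can be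
    absorbed into the sum.\<close>
  also have "\<dots> \<le> (1 + rate I) ^ Suc (card B) * (r + (\<Sum>i\<in>B. fixed_time I i))
      + (1 + rate I) ^ Suc (card B) * fixed_time I i"
    using mult_right_mono[OF one_le_power[of "1 + rate I" "Suc (card B)"] fi] rate
    by (simp add: mult.assoc)
  also have "\<dots> = (1 + rate I) ^ card (insert i B) * (r + (\<Sum>i\<in>insert i B. fixed_time I i))"
    using fin iB by (simp add: algebra_simps)
  finally show ?case using B i
    by (intro exI[of _ r] exI[of _ "insert i B"]) auto
next
  case (wait t S s)
  have "0 \<le> t" using run_feasible[OF val wait.hyps(1)] by blast
  then have "0 \<le> Min (release I ` (jobs I - S))" using wait_forward[OF wait.hyps(2,3)] by linarith
  \<comment> \<open>A wait opens a new empty block at the earliest remaining release, where the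
    bound holds with equality.\<close>
  then show ?case using wait.hyps(3)
    by (intro exI[of _ "Min (release I ` (jobs I - S))"] exI[of _ "{}"]) auto
qed

text \<open>From \<open>1 + \<beta> \<le> exp \<beta>\<close> and
  \<open>m * \<beta> \<le> 1\<close>.\<close>

lemma growth_le_exp:
  assumes "0 \<le> \<beta>" "\<beta> \<le> 1 / real n" "m \<le> n"
  shows "(1 + \<beta>) ^ m \<le> exp 1"
proof -
  have "(1 + \<beta>) ^ m \<le> exp \<beta> ^ m" using assms exp_ge_add_one_self[of \<beta>] by (intro power_mono) auto
  also have "\<dots> = exp (real m * \<beta>)" by (simp add: exp_of_nat_mult)
  \<comment> \<open>This bounds the exponent; the link of the chain is the next inequality. The
    product on the right is 1, or 0 if \<open>n = 0\<close>.\<close>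
  also have "real m * \<beta> \<le> real n * (1 / real n)" using assms by (intro mult_mono) auto
  then have "exp (real m * \<beta>) \<le> exp 1" by (cases "n = 0") auto
  finally show ?thesis .
qed

text \<open>Comparison with an arbitrary feasible \<open>\<sigma>\<close>, since the optimum is an
  infimum. Busy block and work bound share \<open>r\<close> and \<open>B\<close>, leaving only the
  growth factor between them.\<close>

lemma non_idling_makespan_le:
  assumes val: "valid_problem I" and rate: "rate I \<le> 1 / real (num_jobs I)"
    and ni: "non_idling I s" and feas: "feasible I \<sigma>"
  shows "makespan I s \<le> exp 1 * makespan I \<sigma>"
proof -
  obtain t where run: "non_idling_run I t (jobs I) s" using ni by (auto simp: non_idling_def)
  obtain r B where B: "0 \<le> r" "B \<subseteq> jobs I" "B \<noteq> {}" "\<forall>i\<in>B. r \<le> release I i"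
    "t \<le> (1 + rate I) ^ card B * (r + (\<Sum>i\<in>B. fixed_time I i))"
    using run_busy_block[OF val run] by blast
  have "card B \<le> num_jobs I" using card_mono[OF finite_jobs B(2)] by (simp add: jobs_def)
  then have growth: "(1 + rate I) ^ card B \<le> exp 1"
    using val rate by (intro growth_le_exp[of _ "num_jobs I"]) (auto simp: valid_problem_def)
  have "0 \<le> (\<Sum>i\<in>B. fixed_time I i)"
    using val B(2) by (intro sum_nonneg) (auto simp: valid_problem_def)
  then have "t \<le> exp 1 * (r + (\<Sum>i\<in>B. fixed_time I i))"
    using B(1) by (intro order_trans[OF B(5)] mult_right_mono[OF growth]) auto
  also have "\<dots> \<le> exp 1 * makespan I \<sigma>"
    using makespan_ge_release_plus_work[OF val feas B(2,4,3)] by simp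
  finally show ?thesis using makespan_run[OF val run] by simp
qed

lemma non_idling_approximate:
  "is_approximate non_idling {I. valid_problem I \<and> rate I \<le> 1 / real (num_jobs I)} (exp 1)"
  unfolding is_approximate_def
proof (intro ballI conjI allI impI)
  fix I assume "I \<in> {I. valid_problem I \<and> rate I \<le> 1 / real (num_jobs I)}"
  then have I: "valid_problem I" "rate I \<le> 1 / real (num_jobs I)" by auto
  show "\<exists>s. non_idling I s" by (rule non_idling_total)
  fix s assume s: "non_idling I s"
  show feas: "feasible I s" by (rule non_idling_feasible[OF I(1) s])
  have "makespan I s / exp 1 \<le> opt_makespan I"
    using non_idling_makespan_le[OF I s]
    by (intro opt_makespan_greatest[OF feas]) (simp add: field_simps)
  then show "makespan I s \<le> exp 1 * opt_makespan I" by (simp add: field_simps)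
qed

text \<open>Weakens the factor \<open>exp 1\<close> obtained above to \<open>1 + exp 1\<close>; a
  larger factor gives a larger bound because optima are nonnegative.\<close>

lemma is_approximate_mono:
  assumes "is_approximate alg X \<rho>" "\<rho> \<le> \<rho>'" "\<And>I. I \<in> X \<Longrightarrow> 0 \<le> opt_makespan I"
  shows "is_approximate alg X \<rho>'"
  unfolding is_approximate_def
proof (intro ballI conjI allI impI)
  fix I assume I: "I \<in> X"
  show "\<exists>s. alg I s" using assms(1) I by (simp add: is_approximate_def)
  fix s assume s: "alg I s"
  show "feasible I s" using assms(1) I s by (simp add: is_approximate_def)
  have "makespan I s \<le> \<rho> * opt_makespan I" using assms(1) I s by (simp add: is_approximate_def)
  also have "\<dots> \<le> \<rho>' * opt_makespan I" by (rule mult_right_mono[OF assms(2) assms(3)[OF I]])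
  finally show "makespan I s \<le> \<rho>' * opt_makespan I" .
qed

lemma makespan_nonneg:
  assumes "valid_problem I" "feasible I s"
  shows "0 \<le> makespan I s"
proof -
  obtain i where i: "i \<in> jobs I" using jobs_nonempty[OF assms(1)] by blast
  have "0 \<le> s i" by (rule feasible_nonneg[OF assms i])
  then have "0 \<le> completion I i (s i)"
    using assms(1) i by (simp add: completion_def proc_time_def valid_problem_def)
  then show ?thesis using completion_le_makespan[OF i, of s] by linarith
qed

text \<open>An output of the algorithm is the feasible schedule showing that the infimum is over a
  nonempty set.\<close>

lemma opt_makespan_nonneg:
  assumes "valid_problem I"
  shows "0 \<le> opt_makespan I"
proof -
  obtain s where "non_idling I s" using non_idling_total by blast
  then show ?thesis
    using opt_makespan_greatest non_idling_feasible makespan_nonneg assms by metis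
qed

section \<open>The family of bad instances\<close>

text \<open>The common release time of the short jobs is positive, so job 1 is alone at time 0, yet
  so small that \<open>n - 1\<close> short jobs run back to back from there end at
  \<open>1 / (1 + \<beta>)\<close>.\<close>

definition bad_problem :: "real \<Rightarrow> nat \<Rightarrow> problem" where
  "bad_problem \<beta> n = \<lparr>num_jobs = n,
     release = (\<lambda>i. if i = 1 then 0 else 1 / (1 + \<beta>) ^ n),
     fixed_time = (\<lambda>i. if i = 1 then 1 else 0), rate = \<beta>\<rparr>"

lemma bad_problem_sel [simp]:
  "num_jobs (bad_problem \<beta> n) = n"
  "release (bad_problem \<beta> n) i = (if i = 1 then 0 else 1 / (1 + \<beta>) ^ n)"
  "fixed_time (bad_problem \<beta> n) i = (if i = 1 then 1 else 0)"
  "rate (bad_problem \<beta> n) = \<beta>"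
  "jobs (bad_problem \<beta> n) = {1..n}"
  by (auto simp: bad_problem_def jobs_def)

lemma valid_bad_problem: "0 < \<beta> \<Longrightarrow> 1 \<le> n \<Longrightarrow> valid_problem (bad_problem \<beta> n)"
  by (simp add: valid_problem_def)

text \<open>Job 1 is forced to go first and ends at time 1; each later job multiplies the clock by
  \<open>1 + \<beta>\<close>.\<close>

lemma bad_problem_run:
  assumes \<beta>: "0 < \<beta>" and n: "1 \<le> n" and "non_idling_run (bad_problem \<beta> n) t S s"
  shows "(S = {} \<and> t = 0) \<or> (1 \<in> S \<and> finite S \<and> (1 + \<beta>) ^ (card S - 1) \<le> t)"
  using assms(3)
proof induction
  case init
  then show ?case by simp
next
  case (start t S s i)
  have i: "i \<notin> S" "release (bad_problem \<beta> n) i \<le> t" using start.hyps by (auto simp: pending_def)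
  from start.IH show ?case
  proof
    assume S: "S = {} \<and> t = 0"
    have "0 < 1 / (1 + \<beta>) ^ n" using \<beta> by simp
    then have "i = 1" using i(2) S by (auto split: if_splits)
    then show ?thesis using S by (simp add: completion_eq)
  next
    assume S: "1 \<in> S \<and> finite S \<and> (1 + \<beta>) ^ (card S - 1) \<le> t"
    then obtain k where k: "card S = Suc k" by (metis card_eq_0_iff empty_iff not0_implies_Suc)
    have "(1 + \<beta>) * (1 + \<beta>) ^ k \<le> (1 + \<beta>) * t" using S k \<beta> by (intro mult_left_mono) auto
    then show ?thesis using S k i(1) by (auto simp: completion_eq)
  qed
next
  case (wait t S s)
  \<comment> \<open>Waiting is impossible: job 1 is pending until started, and afterwards
    \<open>t \<ge> 1\<close> exceeds or equals every release time.\<close>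
  have "1 / (1 + \<beta>) ^ n \<le> 1" using \<beta> one_le_power[of "1 + \<beta>" n] by (simp add: field_simps)
  moreover have "1 \<le> t" if "1 \<in> S"
    using wait.IH that order_trans[OF one_le_power[of "1 + \<beta>" "card S - 1"], of t] \<beta> by auto
  moreover obtain j where "j \<in> {1..n} - S" using wait.hyps(3) unfolding bad_problem_sel by blast
  ultimately have "(if 1 \<in> S then j else 1) \<in> pending (bad_problem \<beta> n) S t"
    using wait.IH n by (auto simp: pending_def)
  then show ?case using wait.hyps(2) by simp
qed

lemma bad_problem_makespan_ge:
  assumes "0 < \<beta>" "1 \<le> n" "non_idling (bad_problem \<beta> n) s"
  shows "(1 + \<beta>) ^ (n - 1) \<le> makespan (bad_problem \<beta> n) s"
proof -
  obtain t where run: "non_idling_run (bad_problem \<beta> n) t (jobs (bad_problem \<beta> n)) s"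
    using assms(3) by (auto simp: non_idling_def)
  show ?thesis
    using bad_problem_run[OF assms(1,2) run] makespan_run[OF valid_bad_problem[OF assms(1,2)] run]
      assms(2) by simp
qed

lemma bad_problem_feasible_makespan_ge:
  assumes "0 < \<beta>" "1 \<le> n" "feasible (bad_problem \<beta> n) s"
  shows "1 \<le> makespan (bad_problem \<beta> n) s"
  using makespan_ge_release_plus_work[OF valid_bad_problem[OF assms(1,2)] assms(3), of "{1}" 0] assms(2)
  by simp

text \<open>Back to back in the order 2, ..., \<open>n\<close>, 1. Job 2 starts at the common
  release time, hence the exponent \<open>i - 2\<close>; job 1 starts after \<open>n - 1\<close>
  short jobs.\<close>

definition good_schedule :: "real \<Rightarrow> nat \<Rightarrow> schedule" where
  "good_schedule \<beta> n i = (if i = 1 then (1 + \<beta>) ^ (n - 1) else (1 + \<beta>) ^ (i - 2)) / (1 + \<beta>) ^ n"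

lemma completion_good_schedule:
  assumes "0 < \<beta>" "1 \<le> n" "1 \<le> i"
  shows "completion (bad_problem \<beta> n) i (good_schedule \<beta> n i) =
    (if i = 1 then 2 else (1 + \<beta>) ^ (i - 1) / (1 + \<beta>) ^ n)"
proof (cases "i = 1")
  case True
  have "(1 + \<beta>) * (1 + \<beta>) ^ (n - 1) = (1 + \<beta>) ^ n" using assms(2) by (cases n) auto
  moreover have "(1 + \<beta>) ^ n \<noteq> 0" using assms(1) by simp
  ultimately show ?thesis using True by (simp add: completion_eq good_schedule_def)
next
  case False
  then have "i - 1 = Suc (i - 2)" using assms(3) by simp
  then show ?thesis using False by (simp add: completion_eq good_schedule_def)
qed

lemma good_schedule_feasible:
  assumes "0 < \<beta>" "1 \<le> n"
  shows "feasible (bad_problem \<beta> n) (good_schedule \<beta> n)"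
  unfolding feasible_def
proof (intro conjI ballI impI)
  fix i assume "i \<in> jobs (bad_problem \<beta> n)"
  show "release (bad_problem \<beta> n) i \<le> good_schedule \<beta> n i"
    using assms one_le_power[of "1 + \<beta>" "i - 2"] by (simp add: good_schedule_def divide_right_mono)
next
  fix i j assume ij: "i \<in> jobs (bad_problem \<beta> n)" "j \<in> jobs (bad_problem \<beta> n)" "i \<noteq> j"
  have ordered: "completion (bad_problem \<beta> n) i (good_schedule \<beta> n i) \<le> good_schedule \<beta> n j"
    if "1 < i" "i \<le> n" "j = 1 \<or> i < j" for i j
  proof -
    \<comment> \<open>Job 1 comes last and is treated as having index \<open>n + 1\<close>, which
      gives its exponent \<open>n - 1\<close>.\<close>
    have "(1 + \<beta>) ^ (i - 1) \<le> (1 + \<beta>) ^ ((if j = 1 then n + 1 else j) - 2)"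
      using assms that by (intro power_increasing) auto
    then show ?thesis
      using completion_good_schedule[OF assms, of i] assms that
      by (auto simp: good_schedule_def intro!: divide_right_mono split: if_splits)
  qed
  have "(1 < i \<and> (j = 1 \<or> i < j)) \<or> (1 < j \<and> (i = 1 \<or> j < i))" using ij by auto
  then show "completion (bad_problem \<beta> n) i (good_schedule \<beta> n i) \<le> good_schedule \<beta> n j \<or>
      completion (bad_problem \<beta> n) j (good_schedule \<beta> n j) \<le> good_schedule \<beta> n i"
    using ordered[of i j] ordered[of j i] ij by auto
qed

lemma good_schedule_makespan:
  assumes "0 < \<beta>" "1 \<le> n"
  shows "makespan (bad_problem \<beta> n) (good_schedule \<beta> n) \<le> 2"
proof (rule makespan_leI[OF valid_bad_problem[OF assms]])
  fix i assume i: "i \<in> jobs (bad_problem \<beta> n)"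
  have "(1 + \<beta>) ^ (i - 1) \<le> (1 + \<beta>) ^ n" using assms i by (intro power_increasing) auto
  then have "(1 + \<beta>) ^ (i - 1) / (1 + \<beta>) ^ n \<le> 1" using assms by (simp add: field_simps)
  then show "completion (bad_problem \<beta> n) i (good_schedule \<beta> n i) \<le> 2"
    using completion_good_schedule[OF assms, of i] i by simp
qed

lemma bad_problem_opt_ge:
  assumes "0 < \<beta>" "1 \<le> n"
  shows "1 \<le> opt_makespan (bad_problem \<beta> n)"
  using opt_makespan_greatest[OF good_schedule_feasible[OF assms]]
    bad_problem_feasible_makespan_ge[OF assms] by blast

text \<open>The optimum lies between 1 and 2: the upper bound gives the 2 in the denominator, the
  lower bound makes the division legitimate.\<close>

lemma bad_problem_ratio:
  assumes "0 < \<beta>" "1 \<le> n" "non_idling (bad_problem \<beta> n) s"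
  shows "(1 + \<beta>) ^ (n - 1) / 2 \<le> makespan (bad_problem \<beta> n) s / opt_makespan (bad_problem \<beta> n)"
proof -
  note opt = bad_problem_opt_ge[OF assms(1,2)]
  have "opt_makespan (bad_problem \<beta> n) \<le> 2"
    using opt_makespan_lower[OF good_schedule_feasible bad_problem_feasible_makespan_ge]
      good_schedule_makespan assms(1,2) by (meson order_trans)
  moreover have "0 \<le> (1 + \<beta>) ^ (n - 1)" using assms(1) by simp
  then have "0 \<le> makespan (bad_problem \<beta> n) s"
    using bad_problem_makespan_ge[OF assms] by linarith
  ultimately show ?thesis
    using bad_problem_makespan_ge[OF assms] opt by (intro frac_le) auto
qed

theorem theorem13:
  "is_approximate non_idling
     {I. valid_problem I \<and> rate I \<le> 1 / real (num_jobs I)} (1 + exp 1) \<and>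
   (\<forall>B::real. B > 0 \<longrightarrow> (\<exists>c::real. c > 0 \<and> (\<forall>(\<beta>::real) (n::nat). 0 < \<beta> \<and> \<beta> \<le> B \<and> 1 \<le> n \<longrightarrow>
      (\<exists>I. valid_problem I \<and> num_jobs I = n \<and> rate I = \<beta> \<and> 0 < opt_makespan I \<and>
         (\<exists>s. non_idling I s) \<and>
         (\<forall>s. non_idling I s \<longrightarrow> c * (1 + \<beta>) ^ n \<le> makespan I s / opt_makespan I)))))"
proof (intro conjI allI impI)
  show "is_approximate non_idling
      {I. valid_problem I \<and> rate I \<le> 1 / real (num_jobs I)} (1 + exp 1)"
    by (rule is_approximate_mono[OF non_idling_approximate]) (auto intro: opt_makespan_nonneg)
next
  fix B :: real
  assume B: "B > 0"
  \<comment> \<open>In the constant, 2 bounds the optimum and \<open>1 + B\<close> pays for the one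
    factor \<open>1 + \<beta>\<close> between exponents \<open>n - 1\<close> and \<open>n\<close>,
    uniformly in \<open>\<beta> \<le> B\<close>.\<close>
  have main: "\<exists>I. valid_problem I \<and> num_jobs I = n \<and> rate I = \<beta> \<and> 0 < opt_makespan I \<and>
      (\<exists>s. non_idling I s) \<and>
      (\<forall>s. non_idling I s \<longrightarrow> 1 / (2 * (1 + B)) * (1 + \<beta>) ^ n \<le> makespan I s / opt_makespan I)"
    if "0 < \<beta> \<and> \<beta> \<le> B \<and> 1 \<le> n" for \<beta> n
  proof (intro exI[of _ "bad_problem \<beta> n"] conjI allI impI)
    have \<beta>: "0 < \<beta>" "\<beta> \<le> B" and n: "1 \<le> n" using that by auto
    show "valid_problem (bad_problem \<beta> n)" by (rule valid_bad_problem[OF \<beta>(1) n])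
    show "0 < opt_makespan (bad_problem \<beta> n)" using bad_problem_opt_ge[OF \<beta>(1) n] by linarith
    show "\<exists>s. non_idling (bad_problem \<beta> n) s" by (rule non_idling_total)
    fix s assume s: "non_idling (bad_problem \<beta> n) s"
    have "(1 + \<beta>) ^ n = (1 + \<beta>) * (1 + \<beta>) ^ (n - 1)" using n by (cases n) auto
    also have "\<dots> \<le> (1 + B) * (1 + \<beta>) ^ (n - 1)" using \<beta> by (intro mult_right_mono) auto
    finally have "1 / (2 * (1 + B)) * (1 + \<beta>) ^ n \<le> (1 + \<beta>) ^ (n - 1) / 2"
      using B by (simp add: field_simps)
    also have "\<dots> \<le> makespan (bad_problem \<beta> n) s / opt_makespan (bad_problem \<beta> n)"
      by (rule bad_problem_ratio[OF \<beta>(1) n s])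
    finally show "1 / (2 * (1 + B)) * (1 + \<beta>) ^ n
        \<le> makespan (bad_problem \<beta> n) s / opt_makespan (bad_problem \<beta> n)" .
  qed simp_all
  show "\<exists>c>0. \<forall>\<beta> n. 0 < \<beta> \<and> \<beta> \<le> B \<and> 1 \<le> n \<longrightarrow>
      (\<exists>I. valid_problem I \<and> num_jobs I = n \<and> rate I = \<beta> \<and> 0 < opt_makespan I \<and>
        (\<exists>s. non_idling I s) \<and>
        (\<forall>s. non_idling I s \<longrightarrow> c * (1 + \<beta>) ^ n \<le> makespan I s / opt_makespan I))"
    using main B by (intro exI[of _ "1 / (2 * (1 + B))"] conjI allI impI) simp_all
qed

end
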